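(* Let $(G_m)_{m\in\mathbb{Z}}$ be a generalized Fibonacci sequence and let $n\ge 0$ be an integer. Then $$\begin{aligned} \sum_{k=0}^n (-1)^k k^2 G_k G_{n-k} = {}& (-1)^n \frac{1}{2} n \left\{ \left[ (n-1) G_0 - (n+1) G_1 \right] G_n + \left[ (n-1) G_0 + 2 G_1 \right] G_{n+1} \right\} \\ & - \left(1+(-1)^n\right) \left( G_1 G_n - G_0 G_{n+1} \right). \end{aligned}$$
   Context: A generalized Fibonacci sequence is a sequence $(G_m)_{m\in\mathbb{Z}}$ of complex numbers with $G_{m+2}=G_{m+1}+G_m$ for all integers $m$ (with arbitrary seed $G_0,G_1$). *)

theory Defs
  imports Complex_Main
begin

definition generalized_fibonacci :: "(int \<Rightarrow> complex) \<Rightarrow> bool" where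
  "generalized_fibonacci G \<longleftrightarrow> (\<forall>m. G (m + 2) = G (m + 1) + G m)"

end

theory Submission
  imports Defs
begin

(* Split off the terms k = n + 1 and k = n + 2 and apply the recurrence to the second factor of the
   others: the alternating convolution satisfies the Fibonacci recurrence up to boundary terms. The
   closed form satisfies the same inhomogeneous recurrence. *)

lemma generalized_fibonacci_convolution_rec:
  fixes G :: "int \<Rightarrow> complex" and w :: "nat \<Rightarrow> complex"
  assumes "generalized_fibonacci G"
  defines "S \<equiv> \<lambda>n. \<Sum>k = 0..n. w k * G (int k) * G (int n - int k)"
  shows "S (Suc (Suc n)) = S (Suc n) + S n + w (Suc (Suc n)) * G (int n + 2) * G 0
    + w (Suc n) * G (int n + 1) * (G 1 - G 0)"
proof -
  \<comment> \<open>Integer indices make this hold for every \<open>k\<close>, so it rewrites under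
    the sum without a side condition. Since \<open>w k\<close> does not depend on \<open>n\<close>,
    the recurrence passes to the truncated sums.\<close>
  have rec: "G (int n + 2 - int k) = G (int n + 1 - int k) + G (int n - int k)" for k
    using assms(1)[unfolded generalized_fibonacci_def, rule_format, of "int n - int k"]
    by (simp add: algebra_simps)
  have "(\<Sum>k = 0..n. w k * G (int k) * G (int n + 2 - int k)) =
      (\<Sum>k = 0..n. w k * G (int k) * G (int n + 1 - int k)) + S n"
    unfolding S_def sum.distrib[symmetric] rec by (simp add: algebra_simps)
  moreover have "S (Suc n) = (\<Sum>k = 0..n. w k * G (int k) * G (int n + 1 - int k))
      + w (Suc n) * G (int n + 1) * G 0"
    unfolding S_def by (simp add: add.commute)
  moreover have "S (Suc (Suc n)) = (\<Sum>k = 0..n. w k * G (int k) * G (int n + 2 - int k))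
      + w (Suc n) * G (int n + 1) * G 1 + w (Suc (Suc n)) * G (int n + 2) * G 0"
    unfolding S_def by (simp add: add.commute)
  \<comment> \<open>\<open>S (Suc n)\<close> already contains the term \<open>k = n + 1\<close> with
    factor \<open>G 0\<close>, while \<open>S (Suc (Suc n))\<close> has it with factor
    \<open>G 1\<close>; hence \<open>G 1 - G 0\<close>.\<close>
  ultimately show ?thesis
    by (simp add: algebra_simps)
qed

theorem mainTheorem14:
  fixes G :: "int \<Rightarrow> complex" and n :: nat
  assumes "generalized_fibonacci G"
  shows "(\<Sum>k = 0..n. (-1) ^ k * (of_nat k)\<^sup>2 * G (int k) * G (int n - int k)) =
    (-1) ^ n * (1 / 2) * of_nat n *
      (((of_nat n - 1) * G 0 - (of_nat n + 1) * G 1) * G (int n)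
       + ((of_nat n - 1) * G 0 + 2 * G 1) * G (int n + 1))
    - (1 + (-1) ^ n) * (G 1 * G (int n) - G 0 * G (int n + 1))"
proof (induction n rule: induct_nat_012)
  case 0
  then show ?case by simp
next
  case 1
  \<comment> \<open>At n = 1 the closed form contains \<open>G 2\<close>, while the sum is just
    \<open>- (G 1 * G 0)\<close>.\<close>
  have "G 2 = G 1 + G 0"
    using assms[unfolded generalized_fibonacci_def, rule_format, of 0] by simp
  then show ?case by (simp add: algebra_simps)
next
  case (ge2 n)
  have G2: "G (int n + 2) = G (int n + 1) + G (int n)"
    and G3: "G (int n + 3) = G (int n + 2) + G (int n + 1)"
    using assms[unfolded generalized_fibonacci_def, rule_format, of "int n"]
      assms[unfolded generalized_fibonacci_def, rule_format, of "int n + 1"]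
    by (simp_all add: add.assoc)
  have idx: "int (Suc n) = int n + 1" "int n + 1 + 1 = int n + 2"
    "int (Suc (Suc n)) = int n + 2" "int n + 2 + 1 = int n + 3"
    by simp_all
  have cast: "(of_nat (Suc n) :: complex) = of_nat n + 1"
    "(of_nat (Suc (Suc n)) :: complex) = of_nat n + 2"
    by simp_all
  have pow: "(-1 :: complex) ^ Suc n = - ((-1) ^ n)" "(-1 :: complex) ^ Suc (Suc n) = (-1) ^ n"
    by simp_all
  \<comment> \<open>After the induction hypotheses replace both earlier sums, every shifted value
    reduces to \<open>G (int n)\<close> and \<open>G (int n + 1)\<close>. What remains is a
    polynomial identity in these, \<open>G 0\<close>, \<open>G 1\<close>, \<open>of_nat n\<close>
    and \<open>(-1) ^ n\<close>.\<close>
  show ?case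
    unfolding generalized_fibonacci_convolution_rec[OF assms, of "\<lambda>k. (-1) ^ k * (of_nat k)\<^sup>2"] ge2
    unfolding idx cast pow G3 G2
    by (simp add: field_simps power2_eq_square)
qed

end
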